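(* The Jacobi sequence of $e^2$ (where $e$ is Euler's number) is purely periodic, and its smallest period length is $40$.
   Context: For $x\in\mathbb{R}\setminus\mathbb{Q}$ with regular continued fraction expansion $x=[a_0,a_1,a_2,\ldots]$, the convergents $s_k/t_k$ are defined by $s_{-1}=1$, $s_0=a_0$, $s_k=a_ks_{k-1}+s_{k-2}$ and $t_{-1}=0$, $t_0=1$, $t_k=a_kt_{k-1}+t_{k-2}$ for $k\ge1$. For an odd natural number $n$ and an integer $m$ coprime to $n$, $\left(\frac{m}{n}\right)$ is the usual Jacobi symbol (equal to $1$ if $n=1$); if $n$ is even and $\gcd(m,n)=1$, one sets $\left(\frac{m}{n}\right)=*$, a fixed symbol different from $\pm1$. The Jacobi sequence of $x$ is $c_k=\left(\frac{s_k}{t_k}\right)$, $k\ge 0$. It is purely periodic with period length $L\ge1$ if $c_{k+L}=c_k$ for all $k\ge0$; the smallest period length is the least such $L$. *)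

theory Defs
  imports Complex_Main "HOL-Number_Theory.Number_Theory"
begin

fun cf_rem :: "real \<Rightarrow> nat \<Rightarrow> real" where
  "cf_rem x 0 = x"
| "cf_rem x (Suc k) = 1 / (cf_rem x k - of_int \<lfloor>cf_rem x k\<rfloor>)"

definition cf_a :: "real \<Rightarrow> nat \<Rightarrow> int" where
  "cf_a x k = \<lfloor>cf_rem x k\<rfloor>"

(* shifted numerators/denominators: cf_num x (k+1) = s_k, cf_num x 0 = s_{-1} *)
fun cf_num :: "real \<Rightarrow> nat \<Rightarrow> int" where
  "cf_num x 0 = 1"
| "cf_num x (Suc 0) = cf_a x 0"
| "cf_num x (Suc (Suc k)) = cf_a x (Suc k) * cf_num x (Suc k) + cf_num x k"

fun cf_den :: "real \<Rightarrow> nat \<Rightarrow> int" where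
  "cf_den x 0 = 0"
| "cf_den x (Suc 0) = 1"
| "cf_den x (Suc (Suc k)) = cf_a x (Suc k) * cf_den x (Suc k) + cf_den x k"

definition conv_s :: "real \<Rightarrow> nat \<Rightarrow> int" where
  "conv_s x k = cf_num x (Suc k)"

definition conv_t :: "real \<Rightarrow> nat \<Rightarrow> int" where
  "conv_t x k = cf_den x (Suc k)"

definition jacobi :: "int \<Rightarrow> nat \<Rightarrow> int" where
  "jacobi m n = (\<Prod>p\<in>prime_factors n. Legendre m (int p) ^ multiplicity p n)"

(* Jacobi sequence value: Some (m/n) if n odd, None standing for the symbol * if n even *)
definition jacobi_sym :: "int \<Rightarrow> int \<Rightarrow> int option" where
  "jacobi_sym m n = (if odd n then Some (jacobi m (nat n)) else None)"

definition jacobi_seq :: "real \<Rightarrow> nat \<Rightarrow> int option" where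
  "jacobi_seq x k = jacobi_sym (conv_s x k) (conv_t x k)"

definition is_pure_period :: "(nat \<Rightarrow> 'a) \<Rightarrow> nat \<Rightarrow> bool" where
  "is_pure_period c L \<longleftrightarrow> L \<ge> 1 \<and> (\<forall>k. c (k + L) = c k)"

definition purely_periodic :: "(nat \<Rightarrow> 'a) \<Rightarrow> bool" where
  "purely_periodic c \<longleftrightarrow> (\<exists>L. is_pure_period c L)"

definition smallest_period :: "(nat \<Rightarrow> 'a) \<Rightarrow> nat" where
  "smallest_period c = (LEAST L. is_pure_period c L)"

end

(*
  The continued fraction coth 1 = [1; 3, 5, 7, ...] comes from the contiguous relation of a
  hypergeometric (Bessel type) series.  As e^2 = 1 + 2 [3; 5, 7, ...], halving and doubling the
  tails of this expansion yields e^2 = [7; 2, 1, 1, 3, 18, 5, 1, 1, 6, 30, ...], whose partial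
  quotients have period 20 modulo 4.

  Since s_k t_(k-1) = +-1 mod t_k, the symbol (s_k/t_k) equals (t_(k-1)/t_k) up to the sign
  (+-1/t_k).  Whichever of (t_(k-1)/t_k), (t_k/t_(k-1)) has an odd lower entry changes from k to
  k + 1 by a sign that depends only on t_(k-1), t_k and a_(k+1) modulo 4, by reciprocity.  So the
  sequence is produced by a finite automaton, which returns to its initial state after 40 steps.
*)
theory Submission
  imports Defs
begin

section \<open>The continued fraction of the square of e\<close>

text \<open>The reciprocals \<open>1 / r (Suc k)\<close> lie strictly between 0 and 1, so
  \<open>a k\<close> is the floor of \<open>r k\<close> and each step of \<open>cf_rem\<close>
  passes from \<open>r k\<close> to \<open>r (Suc k)\<close>.\<close>

lemma cf_rem_eqI:
  fixes r :: "nat \<Rightarrow> real" and a :: "nat \<Rightarrow> int"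
  assumes r_eq: "\<And>k. r k = of_int (a k) + 1 / r (Suc k)" and r_gt: "\<And>k. r (Suc k) > 1"
  shows "cf_rem (r 0) k = r k"
proof (induction k)
  case (Suc k)
  have "0 < 1 / r (Suc k)" "1 / r (Suc k) < 1"
    using r_gt[of k] by auto
  then have "\<lfloor>r k\<rfloor> = a k"
    using r_eq[of k] by (intro floor_unique) auto
  then show ?case using Suc r_eq[of k] by simp
qed simp

lemma cf_a_eqI:
  fixes r :: "nat \<Rightarrow> real" and a :: "nat \<Rightarrow> int"
  assumes r_eq: "\<And>k. r k = of_int (a k) + 1 / r (Suc k)" and r_gt: "\<And>k. r (Suc k) > 1"
  shows "cf_a (r 0) k = a k"
proof -
  have "0 < 1 / r (Suc k)" "1 / r (Suc k) < 1"
    using r_gt[of k] by auto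
  then show ?thesis
    unfolding cf_a_def cf_rem_eqI[of r a, OF r_eq r_gt]
    using r_eq[of k] by (intro floor_unique) auto
qed

text \<open>Each recursion step multiplies the matrix of convergents by one of determinant -1. This
  makes t_(k-1), up to sign, the inverse of s_k modulo t_k.\<close>

lemma cf_det: "cf_num x (Suc k) * cf_den x k - cf_num x k * cf_den x (Suc k) = - ((-1) ^ k)"
  by (induction k) (auto simp: algebra_simps)

section \<open>A series of Bessel type and the expansion of coth 1\<close>

text \<open>The term is $1 / ((2k)!! (2n+2k-1)!!)$.\<close>

definition bessel_term :: "nat \<Rightarrow> nat \<Rightarrow> real" where
  "bessel_term n k = 2 ^ n * fact (n + k) / (fact k * fact (2 * n + 2 * k))"

definition bessel_sum :: "nat \<Rightarrow> real" where
  "bessel_sum n = (\<Sum>k. bessel_term n k)"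

lemma bessel_term_pos: "bessel_term n k > 0"
  by (simp add: bessel_term_def)

text \<open>Raising n by one extends the odd double factorial in the denominator by the factor
  2n+2k+1.\<close>

lemma bessel_term_Suc_left: "bessel_term n k = of_nat (2 * n + 2 * k + 1) * bessel_term (Suc n) k"
proof -
  have "fact (2 * Suc n + 2 * k) =
      (of_nat (2 * n + 2 * k + 2) * (of_nat (2 * n + 2 * k + 1) * fact (2 * n + 2 * k)) :: real)"
    by (simp add: algebra_simps)
  moreover have "fact (Suc n + k) = (of_nat (n + k + 1) * fact (n + k) :: real)"
    by (simp add: algebra_simps)
  ultimately show ?thesis
    unfolding bessel_term_def by (simp add: divide_simps del: fact_Suc)
qed

text \<open>Both terms contain the same odd double factorial; the even ones differ by the factor
  2k+2.\<close>

lemma bessel_term_shift: "bessel_term (Suc n) k = of_nat (2 * k + 2) * bessel_term n (Suc k)"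
  unfolding bessel_term_def by (simp add: divide_simps)

lemma summable_bessel_term: "summable (bessel_term n)"
proof (rule summable_comparison_test)
  show "\<exists>N. \<forall>k\<ge>N. norm (bessel_term n k) \<le> 2 ^ n * (1 ^ k /\<^sub>R fact k)"
  proof (intro exI allI impI)
    fix k :: nat
    have "fact (n + k) \<le> (fact (2 * n + 2 * k) :: real)" by (rule fact_mono) simp
    then show "norm (bessel_term n k) \<le> 2 ^ n * (1 ^ k /\<^sub>R fact k)"
      using bessel_term_pos[of n k] by (simp add: bessel_term_def divide_simps)
  qed
  show "summable (\<lambda>k. 2 ^ n * ((1::real) ^ k /\<^sub>R fact k))"
    by (intro summable_mult summable_exp_generic)
qed

lemma bessel_sum_pos: "bessel_sum n > 0"
  unfolding bessel_sum_def using summable_bessel_term bessel_term_pos by (rule suminf_pos)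

text \<open>The factor 2n+2k+1 from \<open>bessel_term_Suc_left\<close> splits into 2n+1 and 2k. The
  part with 2k, shifted by one index, is the series for n+2.\<close>

lemma bessel_sum_rec:
  "bessel_sum n = of_nat (2 * n + 1) * bessel_sum (Suc n) + bessel_sum (Suc (Suc n))"
proof -
  have "bessel_term n k = of_nat (2 * n + 1) * bessel_term (Suc n) k
      + of_nat (2 * k) * bessel_term (Suc n) k" for k
    by (subst bessel_term_Suc_left) (simp add: algebra_simps)
  then have split: "of_nat (2 * k) * bessel_term (Suc n) k
      = bessel_term n k - of_nat (2 * n + 1) * bessel_term (Suc n) k" for k
    by simp
  have "(\<lambda>k. of_nat (2 * k) * bessel_term (Suc n) k) sums
      (bessel_sum n - of_nat (2 * n + 1) * bessel_sum (Suc n))"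
    unfolding split bessel_sum_def
    by (intro sums_diff sums_mult summable_sums summable_bessel_term)
  \<comment> \<open>The summand at k = 0 vanishes, so the shift leaves the sum unchanged.\<close>
  then have "(\<lambda>k. of_nat (2 * Suc k) * bessel_term (Suc n) (Suc k)) sums
      (bessel_sum n - of_nat (2 * n + 1) * bessel_sum (Suc n))"
    using sums_Suc_iff[of "\<lambda>k. of_nat (2 * k) * bessel_term (Suc n) k"] by simp
  moreover have "of_nat (2 * Suc k) * bessel_term (Suc n) (Suc k) = bessel_term (Suc (Suc n)) k" for k
    by (subst bessel_term_shift) simp
  ultimately have "bessel_term (Suc (Suc n)) sums
      (bessel_sum n - of_nat (2 * n + 1) * bessel_sum (Suc n))"
    by simp
  then show ?thesis
    unfolding bessel_sum_def[of "Suc (Suc n)"] by (simp add: sums_iff)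
qed

text \<open>The terms reduce to 1/(2k)!, the even part of the exponential series at 1; in
  \<open>bessel_sum_1\<close> they are 1/(2k+1)!, the odd part.\<close>

lemma bessel_sum_0: "bessel_sum 0 = cosh 1"
proof -
  have "(\<lambda>n. if even n then (1::real) ^ n /\<^sub>R fact n else 0) sums cosh 1"
    by (rule cosh_converges)
  then have "(\<lambda>k. if even (2 * k) then (1::real) ^ (2 * k) /\<^sub>R fact (2 * k) else 0) sums cosh 1"
    by (subst sums_mono_reindex[of "\<lambda>k. 2 * k"]) (auto simp: strict_mono_def elim!: evenE)
  moreover have "bessel_term 0 = (\<lambda>k. if even (2 * k) then 1 ^ (2 * k) /\<^sub>R fact (2 * k) else 0)"
    by (rule ext) (simp add: bessel_term_def field_simps)
  ultimately show ?thesis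
    unfolding bessel_sum_def by (simp add: sums_iff)
qed

lemma bessel_sum_1: "bessel_sum (Suc 0) = sinh 1"
proof -
  have "(\<lambda>n. if even n then 0 else (1::real) ^ n /\<^sub>R fact n) sums sinh 1"
    by (rule sinh_converges)
  then have "(\<lambda>k. if even (2 * k + 1) then 0
      else (1::real) ^ (2 * k + 1) /\<^sub>R fact (2 * k + 1)) sums sinh 1"
    by (subst sums_mono_reindex[of "\<lambda>k. 2 * k + 1"])
      (auto simp: strict_mono_def image_iff, metis oddE Suc_eq_plus1)
  moreover have "bessel_term (Suc 0) =
      (\<lambda>k. if even (2 * k + 1) then 0 else 1 ^ (2 * k + 1) /\<^sub>R fact (2 * k + 1))"
    by (rule ext) (simp add: bessel_term_def divide_simps)
  ultimately show ?thesis
    unfolding bessel_sum_def by (simp add: sums_iff)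
qed

text \<open>\<open>coth_tail n\<close> is $[2n+1; 2n+3, 2n+5, \ldots]$.\<close>

definition coth_tail :: "nat \<Rightarrow> real" where
  "coth_tail n = bessel_sum n / bessel_sum (Suc n)"

lemma coth_tail_rec: "coth_tail n = of_nat (2 * n + 1) + 1 / coth_tail (Suc n)"
  using bessel_sum_pos[of "Suc n"] bessel_sum_pos[of "Suc (Suc n)"]
  unfolding coth_tail_def by (subst bessel_sum_rec) (simp add: field_simps)

lemma coth_tail_gt: "coth_tail n > of_nat (2 * n + 1)"
proof -
  have "coth_tail (Suc n) > 0" unfolding coth_tail_def by (simp add: bessel_sum_pos)
  then show ?thesis by (subst coth_tail_rec) simp
qed

text \<open>Compare two forms of coth 1, namely 1 + 2/(e^2 - 1) and 1 +
  1/\<open>coth_tail 1\<close>.\<close>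

lemma exp_2_eq_coth_tail: "exp 2 = 1 + 2 * coth_tail 1"
proof -
  define E :: real where "E = exp 1"
  have E: "E > 1" "E * E \<noteq> 1" "exp (-1) = 1 / E" "exp 2 = E * E"
    by (simp_all add: E_def exp_minus field_simps flip: exp_add)
  have half: "(x / 2) / (y / 2) = x / y" for x y :: real by simp
  have "cosh 1 / sinh 1 = (E + 1 / E) / (E - 1 / E)"
    unfolding sinh_field_def cosh_field_def E(3) E_def[symmetric] by (rule half)
  also have "\<dots> = 1 + 2 / (exp 2 - 1)"
    using E by (simp add: divide_simps)
  finally have "cosh 1 / sinh 1 = 1 + 2 / (exp 2 - 1 :: real)" .
  moreover have "coth_tail 0 = cosh 1 / sinh 1"
    by (simp add: coth_tail_def bessel_sum_0 bessel_sum_1)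
  moreover have "coth_tail 0 = 1 + 1 / coth_tail 1"
    using coth_tail_rec[of 0] by simp
  ultimately have "1 / coth_tail 1 = 2 / (exp 2 - 1)"
    by simp
  moreover have "coth_tail 1 > 0" using coth_tail_gt[of 1] by simp
  moreover have "exp 2 > (1::real)" by simp
  ultimately show ?thesis by (simp add: field_simps)
qed

section \<open>The expansion of e^2\<close>

text \<open>
  The initial partial quotient 7 is omitted: index \<open>k\<close> belongs to the complete quotient \<open>k + 1\<close>.
\<close>

definition exp2_quot :: "nat \<Rightarrow> nat" where
  "exp2_quot k = (let j = k div 5; i = k mod 5 in
     if i = 0 then 3 * j + 2 else if i = 1 then 1 else if i = 2 then 1
     else if i = 3 then 3 * j + 3 else 12 * j + 18)"

text \<open>Halving 6j+5 + 1/Y gives 3j+2 + (Y+1)/(2Y); then 2Y/(Y+1) = 1 + (Y-1)/(Y+1) and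
  (Y+1)/(Y-1) = 1 + 2/(Y-1). With Y = 6j+7 + 1/Z, (Y-1)/2 = 3j+3 + 1/(2Z). With Z = 6j+9 + 1/W, 2Z =
  12j+18 + 2/W, and W/2 starts the next block of five.\<close>

definition exp2_tail :: "nat \<Rightarrow> real" where
  "exp2_tail k = (let j = k div 5; i = k mod 5; Y = coth_tail (3 * j + 3) in
     if i = 0 then coth_tail (3 * j + 2) / 2 else if i = 1 then 2 * Y / (Y + 1)
     else if i = 2 then (Y + 1) / (Y - 1) else if i = 3 then (Y - 1) / 2
     else 2 * coth_tail (3 * j + 4))"

lemma nat_mod5_cases:
  obtains j :: nat where "k = 5 * j" | j where "k = 5 * j + 1" | j where "k = 5 * j + 2"
    | j where "k = 5 * j + 3" | j where "k = 5 * j + 4"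
proof -
  have "k = 5 * (k div 5) \<or> k = 5 * (k div 5) + 1 \<or> k = 5 * (k div 5) + 2
      \<or> k = 5 * (k div 5) + 3 \<or> k = 5 * (k div 5) + 4"
    by presburger
  then show ?thesis using that by blast
qed

lemma div_mod_5:
  fixes j :: nat
  shows "5 * j div 5 = j" "(5 * j + 1) div 5 = j" "(5 * j + 2) div 5 = j"
    "(5 * j + 3) div 5 = j" "(5 * j + 4) div 5 = j"
    "5 * j mod 5 = 0" "(5 * j + 1) mod 5 = 1" "(5 * j + 2) mod 5 = 2"
    "(5 * j + 3) mod 5 = 3" "(5 * j + 4) mod 5 = 4"
  by presburger+

lemma exp2_tail_mod5:
  "exp2_tail (5 * j) = coth_tail (3 * j + 2) / 2"
  "exp2_tail (5 * j + 1) = 2 * coth_tail (3 * j + 3) / (coth_tail (3 * j + 3) + 1)"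
  "exp2_tail (5 * j + 2) = (coth_tail (3 * j + 3) + 1) / (coth_tail (3 * j + 3) - 1)"
  "exp2_tail (5 * j + 3) = (coth_tail (3 * j + 3) - 1) / 2"
  "exp2_tail (5 * j + 4) = 2 * coth_tail (3 * j + 4)"
  unfolding exp2_tail_def Let_def div_mod_5 by simp_all

lemma exp2_quot_mod5:
  "exp2_quot (5 * j) = 3 * j + 2" "exp2_quot (5 * j + 1) = 1" "exp2_quot (5 * j + 2) = 1"
  "exp2_quot (5 * j + 3) = 3 * j + 3" "exp2_quot (5 * j + 4) = 12 * j + 18"
  unfolding exp2_quot_def Let_def div_mod_5 by simp_all

lemma exp2_tail_gt: "exp2_tail k > 1"
proof -
  have gt: "coth_tail (3 * j + 2) > 5" "coth_tail (3 * j + 3) > 7" "coth_tail (3 * j + 4) > 9" for j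
    using coth_tail_gt[of "3 * j + 2"] coth_tail_gt[of "3 * j + 3"] coth_tail_gt[of "3 * j + 4"]
    by simp_all
  show ?thesis
  proof (cases k rule: nat_mod5_cases)
    case (1 j)
    show ?thesis unfolding 1 exp2_tail_mod5 using gt(1)[of j] by linarith
  next
    case (2 j)
    show ?thesis unfolding 2 exp2_tail_mod5 using gt(2)[of j] by (simp add: less_divide_eq)
  next
    case (3 j)
    show ?thesis unfolding 3 exp2_tail_mod5 using gt(2)[of j] by (simp add: less_divide_eq)
  next
    case (4 j)
    show ?thesis unfolding 4 exp2_tail_mod5 using gt(2)[of j] by simp
  next
    case (5 j)
    show ?thesis unfolding 5 exp2_tail_mod5 using gt(3)[of j] by linarith
  qed
qed

lemma exp2_tail_rec: "exp2_tail k = of_nat (exp2_quot k) + 1 / exp2_tail (Suc k)"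
proof -
  have gt: "coth_tail (3 * j + 2) > 5" "coth_tail (3 * j + 3) > 7" "coth_tail (3 * j + 4) > 9" for j
    using coth_tail_gt[of "3 * j + 2"] coth_tail_gt[of "3 * j + 3"] coth_tail_gt[of "3 * j + 4"]
    by simp_all
  have rec: "coth_tail (3 * j + 2) = of_nat (6 * j + 5) + 1 / coth_tail (3 * j + 3)"
    "coth_tail (3 * j + 3) = of_nat (6 * j + 7) + 1 / coth_tail (3 * j + 4)"
    "coth_tail (3 * j + 4) = of_nat (6 * j + 9) + 1 / coth_tail (3 * Suc j + 2)" for j
    using coth_tail_rec[of "3 * j + 2"] coth_tail_rec[of "3 * j + 3"] coth_tail_rec[of "3 * j + 4"]
    by (simp_all add: eval_nat_numeral)
  have Suc: "Suc (5 * j) = 5 * j + 1" "Suc (5 * j + 1) = 5 * j + 2" "Suc (5 * j + 2) = 5 * j + 3"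
    "Suc (5 * j + 3) = 5 * j + 4" "Suc (5 * j + 4) = 5 * Suc j" for j
    by simp_all
  show ?thesis
  proof (cases k rule: nat_mod5_cases)
    case (1 j)
    show ?thesis unfolding 1 Suc exp2_tail_mod5 exp2_quot_mod5
      using gt(2)[of j] rec(1)[of j] by (simp add: field_simps)
  next
    case (2 j)
    show ?thesis unfolding 2 Suc exp2_tail_mod5 exp2_quot_mod5
      using gt(2)[of j] by (simp add: field_simps)
  next
    case (3 j)
    show ?thesis unfolding 3 Suc exp2_tail_mod5 exp2_quot_mod5
      using gt(2)[of j] by (simp add: field_simps)
  next
    case (4 j)
    show ?thesis unfolding 4 Suc exp2_tail_mod5 exp2_quot_mod5
      using gt(3)[of j] rec(2)[of j] by (simp add: field_simps)
  next
    case (5 j)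
    show ?thesis unfolding 5 Suc exp2_tail_mod5 exp2_quot_mod5
      using gt(1)[of "Suc j"] by (subst rec(3)) (simp add: field_simps)
  qed
qed

lemma cf_a_exp2: "cf_a (exp 2) (Suc k) = int (exp2_quot k)"
proof -
  define r where "r n = (case n of 0 \<Rightarrow> exp 2 | Suc m \<Rightarrow> exp2_tail m)" for n
  define a where "a n = (case n of 0 \<Rightarrow> 7 | Suc m \<Rightarrow> int (exp2_quot m))" for n
  \<comment> \<open>The leading quotient 7 is 1 + 2 * 3, where 3 is the leading quotient of
    \<open>coth_tail 1\<close>.\<close>
  have "1 / exp2_tail 0 = 2 / coth_tail 2" by (simp add: exp2_tail_def numeral_2_eq_2)
  moreover have "coth_tail 1 = 3 + 1 / coth_tail 2"
    using coth_tail_rec[of 1] by (simp add: numeral_2_eq_2)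
  ultimately have "exp 2 = 7 + 1 / exp2_tail 0"
    using exp_2_eq_coth_tail by simp
  then have "r n = of_int (a n) + 1 / r (Suc n)" for n
  proof (cases n)
    case (Suc m)
    then show ?thesis using exp2_tail_rec[of m] by (simp add: r_def a_def)
  qed (simp add: r_def a_def)
  moreover have "r (Suc n) > 1" for n
    by (simp add: r_def exp2_tail_gt)
  ultimately have "cf_a (r 0) (Suc k) = a (Suc k)"
    by (rule cf_a_eqI)
  then show ?thesis by (simp add: r_def a_def)
qed

section \<open>Jacobi symbols\<close>

lemma Legendre_cases: "Legendre a p \<in> {-1, 0, 1}"
  by (simp add: Legendre_def)

text \<open>Two such values differ by at most 2, which is less than p. This turns Euler's criterion
  into equalities of symbols.\<close>

lemma sign_eq_of_cong:
  fixes x y p :: int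
  assumes "[x = y] (mod p)" "x \<in> {-1, 0, 1}" "y \<in> {-1, 0, 1}" "p > 2"
  shows "x = y"
proof -
  have "p dvd x - y" using assms(1) by (simp add: cong_iff_dvd_diff)
  moreover have "\<bar>x - y\<bar> < p" using assms by auto
  ultimately show ?thesis using dvd_imp_le_int[of "x - y" p] assms(4) by force
qed

lemma Legendre_cong:
  assumes "[a = b] (mod p)"
  shows "Legendre a p = Legendre b p"
proof -
  have "[x = a] (mod p) \<longleftrightarrow> [x = b] (mod p)" "[a = x] (mod p) \<longleftrightarrow> [b = x] (mod p)" for x
    using assms by (simp_all add: cong_def)
  then show ?thesis by (simp add: Legendre_def QuadRes_def)
qed

lemma Legendre_mult:
  assumes "prime p" "2 < p"
  shows "Legendre (a * b) (int p) = Legendre a (int p) * Legendre b (int p)"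
proof (rule sign_eq_of_cong)
  have "[Legendre (a * b) (int p) = (a * b) ^ ((p - 1) div 2)] (mod int p)"
    using assms by (rule euler_criterion)
  moreover have "[Legendre a (int p) * Legendre b (int p) = (a * b) ^ ((p - 1) div 2)] (mod int p)"
    unfolding power_mult_distrib using assms by (intro cong_mult euler_criterion)
  ultimately show "[Legendre (a * b) (int p) = Legendre a (int p) * Legendre b (int p)] (mod int p)"
    using cong_sym cong_trans by blast
  show "Legendre a (int p) * Legendre b (int p) \<in> {-1, 0, 1}"
    using Legendre_cases[of a p] Legendre_cases[of b p] by auto
qed (use Legendre_cases assms in auto)

section \<open>Multiplicativity of the Jacobi symbol\<close>

text \<open>Additional primes have multiplicity 0 and contribute the factor 1, so symbols with
  different lower entries can be written over a common set of primes.\<close>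

lemma jacobi_eq_prod:
  assumes "finite A" "prime_factors n \<subseteq> A" "\<And>p. p \<in> A \<Longrightarrow> prime p"
  shows "jacobi m n = (\<Prod>p\<in>A. Legendre m (int p) ^ multiplicity p n)"
  unfolding jacobi_def
  by (rule prod.mono_neutral_left) (use assms in \<open>auto simp: prime_factors_multiplicity\<close>)

lemma jacobi_1 [simp]: "jacobi m (Suc 0) = 1"
  by (simp add: jacobi_def)

lemma jacobi_prime: "prime p \<Longrightarrow> jacobi m p = Legendre m (int p)"
  by (simp add: jacobi_def prime_prime_factors)

lemma jacobi_mult_right:
  assumes "a > 0" "b > 0"
  shows "jacobi m (a * b) = jacobi m a * jacobi m b"
proof -
  let ?A = "prime_factors (a * b)"
  have sub: "prime_factors a \<subseteq> ?A" "prime_factors b \<subseteq> ?A"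
    using assms by (auto simp: prime_factors_product)
  have "jacobi m (a * b) =
      (\<Prod>p\<in>?A. Legendre m (int p) ^ multiplicity p a * Legendre m (int p) ^ multiplicity p b)"
    unfolding jacobi_def
  proof (rule prod.cong[OF refl])
    fix p assume "p \<in> ?A"
    then have "prime_elem p"
      using in_prime_factors_imp_prime prime_imp_prime_elem by blast
    then show "Legendre m (int p) ^ multiplicity p (a * b)
        = Legendre m (int p) ^ multiplicity p a * Legendre m (int p) ^ multiplicity p b"
      using assms by (simp add: prime_elem_multiplicity_mult_distrib power_add)
  qed
  also have "\<dots> = jacobi m a * jacobi m b"
    unfolding prod.distrib
    using jacobi_eq_prod[OF _ sub(1)] jacobi_eq_prod[OF _ sub(2)] in_prime_factors_imp_prime[of _ "a * b"]
    by simp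
  finally show ?thesis .
qed

text \<open>Splitting off one odd prime at a time reduces laws for the Jacobi symbol to laws for the
  Legendre symbol.\<close>

lemma odd_nat_prime_induct [consumes 1, case_names one mult]:
  fixes n :: nat
  assumes "odd n" and one: "P 1"
    and mult: "\<And>p n. prime p \<Longrightarrow> p > 2 \<Longrightarrow> odd p \<Longrightarrow> odd n \<Longrightarrow> n > 0 \<Longrightarrow> P n \<Longrightarrow> P (p * n)"
  shows "P n"
  using assms(1)
proof (induction n rule: prime_divisors_induct)
  case (factor p x)
  then have "p \<noteq> 2" "odd p" "odd x" by auto
  moreover have "p \<ge> 2" using factor by (simp add: prime_ge_2_nat)
  ultimately show ?case using factor by (intro mult) (auto intro: Nat.gr0I)
qed (auto simp: one[simplified])

lemma jacobi_mult_left: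
  assumes "odd n"
  shows "jacobi (a * b) n = jacobi a n * jacobi b n"
  using assms
  by (induction n rule: odd_nat_prime_induct)
     (auto simp: jacobi_mult_right jacobi_prime Legendre_mult prime_gt_0_nat)

lemma jacobi_cong:
  assumes "odd n" "[a = b] (mod int n)"
  shows "jacobi a n = jacobi b n"
  using assms
proof (induction n rule: odd_nat_prime_induct)
  case (mult p n)
  have "[a = b] (mod int p)" "[a = b] (mod int n)"
    using mult.prems by (auto intro: cong_dvd_modulus)
  then show ?case using mult Legendre_cong[of a b p]
    by (simp add: jacobi_mult_right jacobi_prime prime_gt_0_nat)
qed simp

lemma jacobi_1_left: "odd n \<Longrightarrow> jacobi 1 n = 1"
proof (induction n rule: odd_nat_prime_induct)
  case (mult p n)
  have "Legendre 1 (int p) = 1"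
    using mult(2) by (auto simp: Legendre_def QuadRes_def cong_def intro: exI[of _ 1])
  then show ?case using mult by (simp add: jacobi_mult_right jacobi_prime prime_gt_0_nat)
qed simp

section \<open>The symbol of -1 and quadratic reciprocity\<close>

definition sgn4 :: "nat \<Rightarrow> int" where
  "sgn4 n = (if n mod 4 = 3 then -1 else 1)"

text \<open>The sign of quadratic reciprocity for odd entries, expressed through residues modulo 4
  so that a finite automaton can read it.\<close>

definition recip :: "nat \<Rightarrow> nat \<Rightarrow> int" where
  "recip m n = (if m mod 4 = 3 \<and> n mod 4 = 3 then -1 else 1)"

lemma odd_mod_4: "odd (n::nat) \<Longrightarrow> n mod 4 = 1 \<or> n mod 4 = 3"
  by presburger

lemma mult_mod_4_eq_3:
  "odd m \<Longrightarrow> odd n \<Longrightarrow> (m * n) mod 4 = 3 \<longleftrightarrow> (m mod 4 = 3) \<noteq> (n mod 4 = (3::nat))"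
  using odd_mod_4[of m] odd_mod_4[of n] by (subst mod_mult_eq[symmetric]) auto

lemma sgn4_mult: "odd m \<Longrightarrow> odd n \<Longrightarrow> sgn4 (m * n) = sgn4 m * sgn4 n"
  by (auto simp: sgn4_def mult_mod_4_eq_3)

lemma recip_mult_left: "odd m \<Longrightarrow> odd n \<Longrightarrow> recip (m * n) q = recip m q * recip n q"
  by (auto simp: recip_def mult_mod_4_eq_3)

lemma recip_commute: "recip m n = recip n m"
  by (auto simp: recip_def)

lemma recip_eq_power:
  assumes "odd m" "odd n"
  shows "recip m n = (-1) ^ ((m - 1) div 2 * ((n - 1) div 2))"
proof -
  have "odd ((k - 1) div 2) \<longleftrightarrow> k mod 4 = 3" if "odd k" for k :: nat
    using that by presburger
  then show ?thesis using assms by (simp add: recip_def minus_one_power_iff)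
qed

lemma jacobi_minus_1: "odd n \<Longrightarrow> jacobi (-1) n = sgn4 n"
proof (induction n rule: odd_nat_prime_induct)
  case (mult p n)
  have "odd ((p - 1) div 2) \<longleftrightarrow> p mod 4 = 3" using mult(3) by presburger
  then have "(-1) ^ ((p - 1) div 2) = sgn4 p" by (auto simp: sgn4_def minus_one_power_iff)
  then have "Legendre (-1) (int p) = sgn4 p"
    using euler_criterion[OF mult(1,2), of "-1"] Legendre_cases[of "-1" p] mult(2)
    by (intro sign_eq_of_cong[of _ _ "int p"]) (auto simp: sgn4_def)
  then show ?case using mult
    by (simp add: jacobi_mult_right jacobi_prime prime_gt_0_nat sgn4_mult)
qed (simp add: sgn4_def)

lemma Legendre_reciprocity:
  assumes "prime p" "2 < p" "prime q" "2 < q" "odd p" "odd q"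
  shows "Legendre (int p) (int q) = recip p q * Legendre (int q) (int p)"
proof (cases "p = q")
  case True
  \<comment> \<open>Both symbols are 0 here.\<close>
  then show ?thesis by (simp add: Legendre_def cong_def)
next
  case False
  then have "Legendre p q * Legendre q p = recip p q"
    using Quadratic_Reciprocity[OF assms(1-4)] recip_eq_power[OF assms(5,6)] by simp
  then show ?thesis
    \<comment> \<open>The product of the symbols is 1 or -1, so both are nonzero and the product law
      can be solved for either one.\<close>
    using Legendre_cases[of p q] Legendre_cases[of q p] by (auto simp: recip_def split: if_splits)
qed

lemma jacobi_reciprocity_prime:
  assumes "odd m" "prime q" "2 < q" "odd q"
  shows "jacobi (int q) m = recip m q * jacobi (int m) q"
  using assms(1)
proof (induction m rule: odd_nat_prime_induct)
  case one
  then show ?case using assms by (simp add: jacobi_1_left recip_def)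
next
  case (mult p n)
  then show ?case using Legendre_reciprocity[of q p] assms recip_commute[of q p]
    by (simp add: jacobi_mult_right Legendre_mult recip_mult_left jacobi_prime prime_gt_0_nat)
qed

text \<open>A second induction, now on the lower entry; \<open>jacobi_reciprocity_prime\<close> has
  already treated a prime against an arbitrary odd number.\<close>

lemma jacobi_reciprocity:
  assumes "odd m" "odd n"
  shows "jacobi (int m) n = recip m n * jacobi (int n) m"
  using assms(2)
proof (induction n rule: odd_nat_prime_induct)
  case one
  then show ?case using assms by (simp add: jacobi_1_left recip_def)
next
  case (mult p n)
  have "recip m p * recip m p = 1" by (simp add: recip_def)
  then have "jacobi (int m) p = recip m p * jacobi (int p) m"
    using jacobi_reciprocity_prime[OF assms(1) mult(1-3)] by simp
  then show ?case using mult assms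
    by (simp add: jacobi_mult_right jacobi_mult_left prime_gt_0_nat
        recip_commute[of m] recip_mult_left)
qed

text \<open>
  Passing from \<open>(d/n) = ((n+d)/n)\<close> to \<open>(n/(n+d)) = (-d/(n+d))\<close> by reciprocity avoids the symbol
  \<open>(2/n)\<close>, so that residues modulo 4 suffice.
\<close>

lemma jacobi_even_add:
  assumes "odd n" "even d"
  shows "jacobi (int d) (n + d) =
    (if d mod 4 = 2 \<and> n mod 4 = 1 then -1 else 1) * jacobi (int d) n"
proof -
  have "jacobi (int d) n = jacobi (int (n + d)) n"
    using assms by (intro jacobi_cong) (auto simp: cong_def)
  also have "\<dots> = recip (n + d) n * jacobi (int n) (n + d)"
    using assms by (intro jacobi_reciprocity) auto
  also have "jacobi (int n) (n + d) = jacobi (- 1 * int d) (n + d)"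
    using assms by (intro jacobi_cong) (auto simp: cong_iff_dvd_diff)
  also have "\<dots> = sgn4 (n + d) * jacobi (int d) (n + d)"
    using assms by (subst jacobi_mult_left) (auto simp: jacobi_minus_1)
  also have "recip (n + d) n * (sgn4 (n + d) * jacobi (int d) (n + d))
      = (recip (n + d) n * sgn4 (n + d)) * jacobi (int d) (n + d)" by simp
  also have "recip (n + d) n * sgn4 (n + d) = (if d mod 4 = 2 \<and> n mod 4 = 1 then -1 else 1)"
  proof -
    have "d mod 4 = 0 \<or> d mod 4 = 2" using assms by presburger
    moreover have "(n + d) mod 4 = n mod 4" if "d mod 4 = 0" using that by presburger
    moreover have "(n + d) mod 4 = 3" if "d mod 4 = 2" "n mod 4 = 1" using that by presburger
    moreover have "(n + d) mod 4 = 1" if "d mod 4 = 2" "n mod 4 = 3" using that by presburger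
    ultimately show ?thesis
      using odd_mod_4[OF assms(1)] by (auto simp: recip_def sgn4_def)
  qed
  finally show ?thesis by simp
qed

text \<open>If d = 2 mod 4, adding d repeatedly alternates the lower entry between the residues 1
  and 3, and the sign changes on each departure from 1. Among a additions there are floor((a+i)/2)
  such departures, with i = 1 if n = 1 mod 4 and i = 0 otherwise. If d = 0 mod 4, the sign never
  changes.\<close>

lemma jacobi_even_add_mult:
  assumes "odd n" "even d"
  shows "jacobi (int d) (a * d + n) =
    (if d mod 4 = 2 \<and> odd ((a + (if n mod 4 = 1 then 1 else 0)) div 2) then -1 else 1)
      * jacobi (int d) n"
proof (induction a)
  case 0
  then show ?case by simp
next
  case (Suc a)
  define i :: nat where "i = (if n mod 4 = 1 then 1 else 0)"
  have turn: "(a * d + n) mod 4 = 1 \<longleftrightarrow> odd (a + i)" if "d mod 4 = 2"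
  proof -
    have "(a * d) mod 4 = (a * 2) mod 4"
      using that mod_mult_right_eq[of a d 4] by simp
    then have "(a * d + n) mod 4 = (a * 2 + n) mod 4"
      by (metis mod_add_left_eq)
    moreover have "(a * 2 + n) mod 4 = 1 \<longleftrightarrow> (if n mod 4 = 1 then even a else odd a)"
      using assms(1) by presburger
    ultimately show ?thesis by (simp add: i_def)
  qed
  have "Suc a + i = Suc (a + i)" by simp
  \<comment> \<open>Passing from k to k + 1 raises floor(k/2) by one exactly when k is odd.\<close>
  moreover have "odd (Suc k div 2) \<longleftrightarrow> odd (k div 2) \<noteq> odd k" for k :: nat
    by (cases "even k") (auto elim!: evenE oddE)
  ultimately have parity: "odd ((Suc a + i) div 2) \<longleftrightarrow> odd ((a + i) div 2) \<noteq> odd (a + i)"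
    by metis
  have "jacobi (int d) (Suc a * d + n) = jacobi (int d) ((a * d + n) + d)"
    by (simp add: algebra_simps)
  also have "\<dots> = (if d mod 4 = 2 \<and> (a * d + n) mod 4 = 1 then -1 else 1)
      * jacobi (int d) (a * d + n)"
    using assms by (intro jacobi_even_add) auto
  finally show ?case
    unfolding Suc.IH i_def[symmetric] parity using turn by (cases "d mod 4 = 2") simp_all
qed

section \<open>The automaton for the Jacobi sequence\<close>

definition jsym :: "nat \<Rightarrow> nat \<Rightarrow> int" where
  "jsym p q = (if odd q then jacobi (int p) q else jacobi (int q) p)"

definition jstate :: "nat \<Rightarrow> nat \<Rightarrow> nat \<times> nat \<times> int" where
  "jstate p q = (p mod 4, q mod 4, jsym p q)"

text \<open>The condition q = r = 3 is the sign of reciprocity; the condition q = 2 is the sign from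
  \<open>jacobi_even_add_mult\<close>.\<close>

fun jstep :: "nat \<Rightarrow> nat \<times> nat \<times> int \<Rightarrow> nat \<times> nat \<times> int" where
  "jstep a (p, q, e) = (let r = (a * q + p) mod 4 in (q, r,
     if q = 3 \<and> r = 3 \<or> q = 2 \<and> odd ((a + (if p = 1 then 1 else 0)) div 2) then - e else e))"

text \<open>For odd q, (p/q) = ((aq+p)/q), and reciprocity inverts this symbol if aq+p is odd. For
  even q, both p and aq+p are odd, and (q/p) is compared with (q/(aq+p)).\<close>

lemma jsym_step:
  assumes "odd p \<or> odd q"
  shows "jsym q (a * q + p) =
    (if q mod 4 = 3 \<and> (a * q + p) mod 4 = 3 \<or>
        q mod 4 = 2 \<and> odd ((a + (if p mod 4 = 1 then 1 else 0)) div 2) then - jsym p q else jsym p q)"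
proof (cases "odd q")
  case True
  then have "jacobi (int (a * q + p)) q = jacobi (int p) q"
    by (intro jacobi_cong) (auto simp: cong_def)
  moreover have "q mod 4 \<noteq> 2" using True by presburger
  moreover have "r mod 4 \<noteq> 3" if "even r" for r :: nat using that by presburger
  ultimately show ?thesis using True jacobi_reciprocity[of q "a * q + p"]
    by (auto simp: jsym_def recip_def)
next
  case False
  then have "odd p" "q mod 4 \<noteq> 3" using assms by presburger+
  then show ?thesis using False jacobi_even_add_mult[of p q a]
    by (auto simp: jsym_def)
qed

lemma jstate_step:
  assumes "odd p \<or> odd q"
  shows "jstate q (a * q + p) = jstep a (jstate p q)"
proof -
  have "(a * (q mod 4) + p mod 4) mod 4 = (a * q + p) mod 4"
    by (intro mod_add_cong mod_mult_right_eq mod_mod_trivial)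
  then show ?thesis
    unfolding jstate_def jstep.simps Let_def jsym_step[OF assms] by simp
qed

text \<open>Changing a by a multiple of 4 changes the halved quantity by an even number, so its
  parity is preserved.\<close>

lemma jstep_mod_4: "jstep (a mod 4) s = jstep a s"
proof (cases s)
  case (fields p q e)
  have "odd ((a mod 4 + i) div 2) \<longleftrightarrow> odd ((a + i) div 2)" for i
  proof -
    have "a + i = 2 * (2 * (a div 4)) + (a mod 4 + i)" by simp
    then have "(a + i) div 2 = 2 * (a div 4) + (a mod 4 + i) div 2"
      by (metis div_mult_self4 zero_neq_numeral)
    then show ?thesis by simp
  qed
  moreover have "(a mod 4 * q + p) mod 4 = (a * q + p) mod 4"
    by (intro mod_add_cong mod_mult_left_eq refl)
  ultimately show ?thesis unfolding fields jstep.simps Let_def by simp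
qed

lemma jacobi_cases:
  assumes "odd n"
  shows "jacobi m n \<in> {-1, 0, 1}"
  using assms
proof (induction n rule: odd_nat_prime_induct)
  case (mult p n)
  then show ?case using Legendre_cases[of m "int p"]
    by (auto simp: jacobi_mult_right jacobi_prime prime_gt_0_nat)
qed simp

section \<open>From convergents to states\<close>

text \<open>Indices as in \<open>cf_den\<close>: \<open>denom a k\<close> is $t_{k-1}$.\<close>

fun denom :: "(nat \<Rightarrow> nat) \<Rightarrow> nat \<Rightarrow> nat" where
  "denom a 0 = 0"
| "denom a (Suc 0) = 1"
| "denom a (Suc (Suc k)) = a k * denom a (Suc k) + denom a k"

lemma cf_den_eq_denom:
  assumes "\<And>k. cf_a x (Suc k) = int (a k)"
  shows "cf_den x k = int (denom a k)"
  using assms by (induction x k rule: cf_den.induct) auto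

lemma denom_odd: "odd (denom a k) \<or> odd (denom a (Suc k))"
  by (induction k) auto

lemma jacobi_seq_eq_jstate:
  assumes a: "\<And>k. cf_a x (Suc k) = int (a k)"
  shows "jacobi_seq x k = (case jstate (denom a k) (denom a (Suc k)) of
    (p, q, e) \<Rightarrow> if even q then None else Some (if even k \<and> q = 3 then - e else e))"
proof (cases "odd (denom a (Suc k))")
  case True
  let ?s = "cf_num x (Suc k)" and ?t = "denom a (Suc k)" and ?u = "denom a k"
  \<comment> \<open>The determinant identity: s_k t_(k-1) is -1 modulo t_k for even k and 1 for odd
    k.\<close>
  have "?s * int ?u = cf_num x k * int ?t - (-1) ^ k"
    using cf_det[of x k] by (simp add: cf_den_eq_denom[of x a, OF a])
  then have "[?s * int ?u = - ((-1) ^ k)] (mod int ?t)"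
    by (simp add: cong_iff_dvd_diff)
  then have "jacobi ?s ?t * jacobi (int ?u) ?t = jacobi (- ((-1) ^ k)) ?t"
    using True by (simp add: jacobi_cong flip: jacobi_mult_left)
  also have "\<dots> = (if even k then sgn4 ?t else 1)"
    using True by (simp add: jacobi_minus_1 jacobi_1_left)
  \<comment> \<open>The product of the two symbols is 1 or -1, so each is its own inverse and one
    can be moved across.\<close>
  finally have "jacobi ?s ?t = (if even k then sgn4 ?t else 1) * jacobi (int ?u) ?t"
    using jacobi_cases[OF True, of ?s] jacobi_cases[OF True, of "int ?u"]
    by (auto simp: sgn4_def split: if_splits)
  then show ?thesis using True
    by (simp add: jacobi_seq_def jacobi_sym_def conv_s_def conv_t_def cf_den_eq_denom[of x a, OF a]
        jstate_def jsym_def sgn4_def dvd_mod_iff)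
next
  case False
  then show ?thesis
    by (simp add: jacobi_seq_def jacobi_sym_def conv_t_def cf_den_eq_denom[of x a, OF a] jstate_def
        dvd_mod_iff)
qed

section \<open>The orbit belonging to e^2 and its period\<close>

text \<open>The initial state encodes t_(-1) = 0, t_0 = 1 and the symbol (0/1) = 1.\<close>

fun exp2_state :: "nat \<Rightarrow> nat \<times> nat \<times> int" where
  "exp2_state 0 = (0, 1, 1)"
| "exp2_state (Suc k) = jstep (exp2_quot k mod 4) (exp2_state k)"

fun exp2_symbol :: "nat \<Rightarrow> nat \<times> nat \<times> int \<Rightarrow> int option" where
  "exp2_symbol k (p, q, e) = (if even q then None else Some (if even k \<and> q = 3 then - e else e))"

lemma jstate_exp2: "jstate (denom exp2_quot k) (denom exp2_quot (Suc k)) = exp2_state k"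
proof (induction k)
  case 0
  show ?case by (simp add: jstate_def jsym_def)
next
  case (Suc k)
  then show ?case
    using jstate_step[OF denom_odd[of exp2_quot k], of "exp2_quot k"] by (simp add: jstep_mod_4)
qed

text \<open>Twenty indices raise j by 4, hence every quotient by 0, 12 or 48.\<close>

lemma exp2_quot_add_20: "exp2_quot (k + 20) mod 4 = exp2_quot k mod 4"
proof -
  have div_mod: "(k + 20) div 5 = k div 5 + 4" "(k + 20) mod 5 = k mod 5" by presburger+
  have "(3 * (j + 4) + 2) mod 4 = (3 * j + 2) mod 4" "(3 * (j + 4) + 3) mod 4 = (3 * j + 3) mod 4"
    "(12 * (j + 4) + 18) mod 4 = (12 * j + 18) mod 4" for j :: nat
    by presburger+
  then show ?thesis
    unfolding exp2_quot_def Let_def div_mod by (simp only: if_distrib[of "\<lambda>n. n mod 4"])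
qed

text \<open>After 20 steps the residues are back at (0, 1) but the sign is reversed; another 20
  steps restore it. Evaluation of the base case suffices, since the quotients modulo 4
  repeat.\<close>

lemma exp2_state_add_40: "exp2_state (k + 40) = exp2_state k"
proof (induction k)
  case 0
  show ?case by code_simp
next
  case (Suc k)
  have "exp2_quot (k + 40) mod 4 = exp2_quot k mod 4"
    using exp2_quot_add_20[of "k + 20"] exp2_quot_add_20[of k] by (simp add: add.commute)
  then show ?case unfolding add_Suc exp2_state.simps Suc.IH by simp
qed

lemma exp2_state_mod_40: "exp2_state k = exp2_state (k mod 40)"
proof -
  have "exp2_state (k mod 40 + 40 * i) = exp2_state (k mod 40)" for i
  proof (induction i)
    case (Suc i)
    then show ?case using exp2_state_add_40[of "k mod 40 + 40 * i"] by (simp add: algebra_simps)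
  qed simp
  from this[of "k div 40"] show ?thesis by simp
qed

text \<open>The values c_0 to c_39. The second half is the first with all signs reversed and
  \<open>None\<close> in the same places.\<close>

definition exp2_pattern :: "int option list" where
  "exp2_pattern = [
    Some 1, None, Some 1, Some (- 1), None, Some 1, Some (- 1), None,
    Some (- 1), None, Some 1, None, Some (- 1), Some (- 1), None, Some (- 1),
    Some (- 1), None, Some (- 1), None, Some (- 1), None, Some (- 1), Some 1,
    None, Some (- 1), Some 1, None, Some 1, None, Some (- 1), None,
    Some 1, Some 1, None, Some 1, Some 1, None, Some 1, None]"

lemma jacobi_seq_exp2: "jacobi_seq (exp 2) k = exp2_pattern ! (k mod 40)"
proof -
  have "jacobi_seq (exp 2) k = exp2_symbol k (exp2_state k)"
    using jacobi_seq_eq_jstate[of "exp 2" exp2_quot, OF cf_a_exp2, of k]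
    unfolding jstate_exp2 by (cases "exp2_state k") simp
  \<comment> \<open>The modulus 40 is even, so reducing k preserves the parity on which
    \<open>exp2_symbol\<close> depends.\<close>
  also have "\<dots> = exp2_symbol (k mod 40) (exp2_state (k mod 40))"
    by (subst exp2_state_mod_40, cases "exp2_state (k mod 40)") (simp add: dvd_mod_iff)
  also have "\<dots> = map (\<lambda>i. exp2_symbol i (exp2_state i)) [0..<40] ! (k mod 40)"
    by simp
  also have "map (\<lambda>i. exp2_symbol i (exp2_state i)) [0..<40] = exp2_pattern"
    unfolding exp2_pattern_def by code_simp
  finally show ?thesis .
qed

text \<open>Each shift below 40 is refuted by evaluation; wrapping indices modulo 40 confines the
  comparison to the finite list.\<close>

lemma exp2_pattern_not_periodic:
  "\<forall>L\<in>{1..<40}. \<exists>k\<in>{..<40}. exp2_pattern ! ((k + L) mod 40) \<noteq> exp2_pattern ! k"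
  by code_simp

theorem theorem6:
  shows "purely_periodic (jacobi_seq (exp 2)) \<and> smallest_period (jacobi_seq (exp 2)) = 40"
proof
  have period: "is_pure_period (jacobi_seq (exp 2)) 40"
    by (simp add: is_pure_period_def jacobi_seq_exp2)
  then show "purely_periodic (jacobi_seq (exp 2))"
    unfolding purely_periodic_def by blast
  have "40 \<le> L" if L: "is_pure_period (jacobi_seq (exp 2)) L" for L
  proof (rule ccontr)
    assume "\<not> 40 \<le> L"
    then have "L \<in> {1..<40}" using L by (simp add: is_pure_period_def)
    then obtain k where "k < 40" "exp2_pattern ! ((k + L) mod 40) \<noteq> exp2_pattern ! k"
      using exp2_pattern_not_periodic by blast
    then have "jacobi_seq (exp 2) (k + L) \<noteq> jacobi_seq (exp 2) k"
      by (simp add: jacobi_seq_exp2)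
    then show False using L by (simp add: is_pure_period_def)
  qed
  with period show "smallest_period (jacobi_seq (exp 2)) = 40"
    unfolding smallest_period_def by (intro Least_equality)
qed

end
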